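(* Let $\mathcal{A}:\mathbb{R}^{m\times n}\to\mathbb{R}^p$ be a linear map and suppose that $b=\mathcal{A}X+e$, where $X\in\mathbb{R}^{m\times n}$ is an arbitrary matrix and $e\in\mathbb{R}^p$. Suppose $\mathcal{A}$ has the restricted isometry property with $\delta_{3r}(\mathcal{A})\le\alpha/\sqrt{8}$, where $\alpha\in(0,1)$. Let $X_r$ be the best rank-$r$ approximation to $X$. Let $X^0,X^1,X^2,\ldots$ be the iterates produced by the algorithm IHTMS (Iterative Hard Thresholding with Matrix Shrinkage, defined in the context) with data $\mathcal{A},b,r$, threshold $\mu>0$ and given initial matrix $X^0\in\mathbb{R}^{m\times n}$. Then, at iteration $k$, IHTMS will recover an approximation $X^k$ satisfying $$\|X-X^k\|_F\le\alpha^k\|X_r-X^0\|_F+\gamma\tilde{\epsilon}_r+\frac{2\mu\sqrt{m}}{1-\alpha},$$ where $\gamma:=\frac{\beta^2}{2(1-\alpha)}+1$, $\beta:=2\sqrt{1+\alpha/\sqrt{8}}$, and $$\tilde{\epsilon}_r=\|X-X_r\|_F+\frac{1}{\sqrt{r}}\|X-X_r\|_*+\|e\|_2 .$$ Furthermore, after at most $$k^*:=\left\lceil\log_{1/\alpha}\left(\|X_r-X^0\|_F/(\tilde{\epsilon}_r+2\mu\sqrt{m})\right)\right\rceil$$ iterations, IHTMS estimates $X$ with accuracy $$\|X-X^{k^*}\|_F\le(1+\gamma)\tilde{\epsilon}_r+\frac{2-\alpha}{1-\alpha}\,2\mu\sqrt{m}.$$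
   Context: Throughout $m\le n$. $\|\cdot\|_F$ is the Frobenius norm on $\mathbb{R}^{m\times n}$ (with inner product $\langle X,Y\rangle=\mathrm{Tr}(X^\top Y)$), $\|\cdot\|_*$ is the nuclear norm (sum of singular values), $\|\cdot\|_2$ is the Euclidean norm on $\mathbb{R}^p$, and $\mathcal{A}^*:\mathbb{R}^p\to\mathbb{R}^{m\times n}$ is the adjoint of $\mathcal{A}$. $\mathcal{A}X$ means $\mathcal{A}(X)$. Restricted isometry constant: for an integer $s$ with $1\le s\le m$, $\delta_s(\mathcal{A})$ is the minimum constant such that $(1-\delta_s(\mathcal{A}))\|X\|_F^2\le\|\mathcal{A}X\|_2^2\le(1+\delta_s(\mathcal{A}))\|X\|_F^2$ for all $X\in\mathbb{R}^{m\times n}$ with $\mathrm{rank}(X)\le s$. Best rank-$r$ approximation (hard thresholding): if $X=\sum_{i=1}^m\sigma_iu_iv_i^\top$ is the singular value decomposition of $X$ with $\sigma_1\ge\cdots\ge\sigma_m$, then $R_r(X)=\sum_{i=1}^r\sigma_iu_iv_i^\top$. Matrix shrinkage operator (soft thresholding): if $X=U\,\mathrm{Diag}(\sigma)V^\top$ is the singular value decomposition of $X$ and $\nu>0$, then $S_\nu(X)=U\,\mathrm{Diag}((\sigma-\nu)_+)V^\top$, where $a_+:=\max(a,0)$ is applied componentwise. Algorithm IHTMS: given $X^0$, $\mu>0$ and $r$, for $k=0,1,2,\ldots$ set $Y^{k+1}:=X^k-\mathcal{A}^*(\mathcal{A}X^k-b)$ and $X^{k+1}:=R_r(S_\mu(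Y^{k+1}))$.
   Formalization: The formal theorem additionally assumes that the initial matrix X^0 has rank at most r; for X^0 of arbitrary rank the stated bound can fail already at k = 1 (e.g. X = 0, e = 0, X^0 a large multiple of the identity, m > 72r). *)

theory Defs
  imports "HOL-Analysis.Analysis"
begin

text \<open>Real \<open>m \<times> n\<close> matrices are elements of \<open>real^'n^'m\<close>. The library's \<open>norm\<close> and inner product on this
  type are the Frobenius norm and \<open>Tr (X\<^sup>T Y)\<close>, and \<open>adjoint\<close> is taken with respect to them. All
  definitions concern the case \<open>m \<le> n\<close>; otherwise there are no \<open>m\<close> orthonormal right singular vectors.\<close>

definition outer_product :: "real^'m \<Rightarrow> real^'n \<Rightarrow> real^'n^'m" where
  "outer_product u v = (columnvector u :: real^1^'m) ** (rowvector v :: real^'n^1)"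

text \<open>\<open>X = \<Sum>\<^sub>i \<sigma>\<^sub>i u\<^sub>i v\<^sub>i\<^sup>T\<close> with \<open>\<sigma>\<^sub>1 \<ge> \<dots> \<ge> \<sigma>\<^sub>m \<ge> 0\<close>. The families are indexed by natural
  numbers, and only their values on \<open>{1..m}\<close> matter. Zero singular values are included.\<close>

definition is_svd ::
  "real^'n^'m \<Rightarrow> (nat \<Rightarrow> real^'m) \<Rightarrow> (nat \<Rightarrow> real) \<Rightarrow> (nat \<Rightarrow> real^'n) \<Rightarrow> bool" where
  "is_svd X u \<sigma> v \<longleftrightarrow>
     (\<forall>i\<in>{1..CARD('m)}. \<forall>j\<in>{1..CARD('m)}. u i \<bullet> u j = (if i = j then 1 else 0)) \<and>
     (\<forall>i\<in>{1..CARD('m)}. \<forall>j\<in>{1..CARD('m)}. v i \<bullet> v j = (if i = j then 1 else 0)) \<and>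
     (\<forall>i\<in>{1..CARD('m)}. \<sigma> i \<ge> 0) \<and>
     (\<forall>i\<in>{1..CARD('m)}. \<forall>j\<in>{1..CARD('m)}. i \<le> j \<longrightarrow> \<sigma> j \<le> \<sigma> i) \<and>
     X = (\<Sum>i=1..CARD('m). \<sigma> i *\<^sub>R outer_product (u i) (v i))"

text \<open>The singular values do not depend on the chosen decomposition.\<close>

definition singular_values :: "real^'n^'m \<Rightarrow> nat \<Rightarrow> real" where
  "singular_values X = (SOME \<sigma>. \<exists>u v. is_svd X u \<sigma> v)"

definition nuclear_norm :: "real^'n^'m \<Rightarrow> real" where
  "nuclear_norm X = (\<Sum>i=1..CARD('m). singular_values X i)"

text \<open>\<open>Z = R\<^sub>r(X)\<close>. This is a relation because the truncation depends on the chosen decomposition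
  when \<open>\<sigma>\<^sub>r = \<sigma>\<^sub>r\<^sub>+\<^sub>1 > 0\<close>; any choice is allowed. It is meant for \<open>r \<le> m\<close>.\<close>

definition is_best_rank_approx :: "nat \<Rightarrow> real^'n^'m \<Rightarrow> real^'n^'m \<Rightarrow> bool" where
  "is_best_rank_approx r X Z \<longleftrightarrow>
     (\<exists>u \<sigma> v. is_svd X u \<sigma> v \<and> Z = (\<Sum>i=1..r. \<sigma> i *\<^sub>R outer_product (u i) (v i)))"

text \<open>\<open>Z = S\<^sub>\<nu>(X)\<close>.\<close>

definition is_shrinkage :: "real \<Rightarrow> real^'n^'m \<Rightarrow> real^'n^'m \<Rightarrow> bool" where
  "is_shrinkage \<nu> X Z \<longleftrightarrow>
     (\<exists>u \<sigma> v. is_svd X u \<sigma> v \<and>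
        Z = (\<Sum>i=1..CARD('m). max (\<sigma> i - \<nu>) 0 *\<^sub>R outer_product (u i) (v i)))"

text \<open>The restricted isometry constant. For linear \<open>\<A>\<close> the minimum exists.\<close>

definition ric :: "(real^'n^'m \<Rightarrow> real^'p) \<Rightarrow> nat \<Rightarrow> real" where
  "ric \<A> s = (LEAST \<delta>. \<forall>X. rank X \<le> s \<longrightarrow>
     (1 - \<delta>) * (norm X)\<^sup>2 \<le> (norm (\<A> X))\<^sup>2 \<and> (norm (\<A> X))\<^sup>2 \<le> (1 + \<delta>) * (norm X)\<^sup>2)"

text \<open>\<open>Xs\<close> is a sequence of iterates of IHTMS started at \<open>X0\<close>.\<close>

definition is_IHTMS ::
  "(real^'n^'m \<Rightarrow> real^'p) \<Rightarrow> real^'p \<Rightarrow> nat \<Rightarrow> real \<Rightarrow> real^'n^'m \<Rightarrow> (nat \<Rightarrow> real^'n^'m) \<Rightarrow> bool" where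
  "is_IHTMS \<A> b r \<mu> X0 Xs \<longleftrightarrow>
     Xs 0 = X0 \<and>
     (\<forall>k. \<exists>Y S. Y = Xs k - adjoint \<A> (\<A> (Xs k) - b) \<and>
        is_shrinkage \<mu> Y S \<and> is_best_rank_approx r S (Xs (Suc k)))"

end

theory Submission
  imports Defs
begin

text \<open>Absorb the tail of \<open>X\<close> into the noise: \<open>b = \<A> X\<^sub>r + e'\<close> with \<open>e' = \<A> (X - X\<^sub>r) + e\<close>, where cutting
  \<open>X - X\<^sub>r\<close> into blocks of \<open>r\<close> singular values bounds \<open>\<parallel>e'\<parallel>\<close> by a multiple of \<open>\<epsilon>\<close>. Let \<open>S\<close> be the
  shrinkage of \<open>Y = Y\<^sup>k\<^sup>+\<^sup>1\<close> and \<open>D = X\<^sub>r - X\<^sup>k\<^sup>+\<^sup>1\<close>. As \<open>X\<^sup>k\<^sup>+\<^sup>1\<close> is at least as close to \<open>S\<close> as \<open>X\<^sub>r\<close>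
  (Eckart--Young), \<open>\<parallel>D\<parallel>\<^sup>2 \<le> 2 \<langle>D, X\<^sub>r - S\<rangle>\<close>. Here \<open>\<parallel>Y - S\<parallel> \<le> \<mu> \<surd>m\<close>, and \<open>\<langle>D, X\<^sub>r - Y\<rangle>\<close> is controlled by
  the restricted isometry property because \<open>X\<^sub>r\<close>, \<open>X\<^sup>k\<close>, \<open>X\<^sup>k\<^sup>+\<^sup>1\<close> only span matrices of rank at most
  \<open>3r\<close>. So \<open>\<parallel>X\<^sub>r - X\<^sup>k\<parallel>\<close> satisfies a linear recurrence with factor \<open>2 \<delta> \<le> \<alpha>\<close>.\<close>

section \<open>Orthonormal families, and a weighted-sum inequality\<close>

definition orthonormal_on :: "'i set \<Rightarrow> ('i \<Rightarrow> 'a::real_inner) \<Rightarrow> bool" where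
  "orthonormal_on I f \<longleftrightarrow> (\<forall>i\<in>I. \<forall>j\<in>I. f i \<bullet> f j = (if i = j then 1 else 0))"

lemma orthonormal_onD:
  "orthonormal_on I f \<Longrightarrow> i \<in> I \<Longrightarrow> j \<in> I \<Longrightarrow> f i \<bullet> f j = (if i = j then 1 else 0)"
  by (simp add: orthonormal_on_def)

lemma orthonormal_on_inner_sum:
  assumes "orthonormal_on I f" "finite I" "i \<in> I"
  shows "f i \<bullet> (\<Sum>j\<in>I. c j *\<^sub>R f j) = c i"
proof -
  have "f i \<bullet> (\<Sum>j\<in>I. c j *\<^sub>R f j) = (\<Sum>j\<in>I. if i = j then c j else 0)"
    using assms(1,3) by (auto simp: inner_sum_right orthonormal_onD intro!: sum.cong)
  then show ?thesis
    using assms(2,3) by simp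
qed

lemma orthonormal_on_norm_sum:
  assumes "orthonormal_on I f" "finite I"
  shows "(norm (\<Sum>i\<in>I. c i *\<^sub>R f i))\<^sup>2 = (\<Sum>i\<in>I. (c i)\<^sup>2)"
proof -
  have "(norm (\<Sum>i\<in>I. c i *\<^sub>R f i))\<^sup>2 = (\<Sum>i\<in>I. c i * (f i \<bullet> (\<Sum>j\<in>I. c j *\<^sub>R f j)))"
    by (simp add: power2_norm_eq_inner inner_sum_left)
  also have "\<dots> = (\<Sum>i\<in>I. (c i)\<^sup>2)"
    using assms by (auto simp: orthonormal_on_inner_sum power2_eq_square intro!: sum.cong)
  finally show ?thesis .
qed

lemma orthonormal_on_norm_projection_residual:
  assumes "orthonormal_on I f" "finite I"
  shows "(norm (x - (\<Sum>i\<in>I. (f i \<bullet> x) *\<^sub>R f i)))\<^sup>2 = (norm x)\<^sup>2 - (\<Sum>i\<in>I. (f i \<bullet> x)\<^sup>2)"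
proof -
  let ?p = "\<Sum>i\<in>I. (f i \<bullet> x) *\<^sub>R f i"
  have "x \<bullet> ?p = (\<Sum>i\<in>I. (f i \<bullet> x)\<^sup>2)"
    by (simp add: inner_sum_right power2_eq_square inner_commute)
  moreover have "?p \<bullet> ?p = (\<Sum>i\<in>I. (f i \<bullet> x)\<^sup>2)"
    using orthonormal_on_norm_sum[OF assms, of "\<lambda>i. f i \<bullet> x"] by (simp add: power2_norm_eq_inner)
  ultimately show ?thesis
    by (simp add: power2_norm_eq_inner inner_diff_left inner_diff_right inner_commute)
qed

lemma bessel_inequality:
  assumes "orthonormal_on I f" "finite I"
  shows "(\<Sum>i\<in>I. (f i \<bullet> x)\<^sup>2) \<le> (norm x)\<^sup>2"
  using orthonormal_on_norm_projection_residual[OF assms, of x]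
    zero_le_power2[of "norm (x - (\<Sum>i\<in>I. (f i \<bullet> x) *\<^sub>R f i))"] by linarith

text \<open>By Pythagoras: the left side is the squared distance from \<open>x\<close> to its
  projection on the span, and \<open>z\<close> differs from that projection by a vector of the
  span.\<close>

lemma orthonormal_on_norm_residual_le:
  assumes "orthonormal_on I f" "finite I" "z \<in> span (f ` I)"
  shows "(norm x)\<^sup>2 - (\<Sum>i\<in>I. (f i \<bullet> x)\<^sup>2) \<le> (norm (x - z))\<^sup>2"
proof -
  let ?p = "\<Sum>i\<in>I. (f i \<bullet> x) *\<^sub>R f i"
  have "orthogonal (x - ?p) (f i)" if "i \<in> I" for i
    using orthonormal_on_inner_sum[OF assms(1,2) that, of "\<lambda>i. f i \<bullet> x"]
    by (simp add: orthogonal_def inner_commute[of _ "f i"] inner_diff_right)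
  moreover have "?p \<in> span (f ` I)"
    by (intro span_sum span_scale span_base) auto
  ultimately have "orthogonal (x - ?p) (?p - z)"
    using orthogonal_to_span[OF span_diff[OF _ assms(3)], of ?p "x - ?p"] by blast
  then have "(norm ((x - ?p) + (?p - z)))\<^sup>2 = (norm (x - ?p))\<^sup>2 + (norm (?p - z))\<^sup>2"
    by (rule norm_add_Pythagorean)
  then show ?thesis
    using orthonormal_on_norm_projection_residual[OF assms(1,2), of x] by simp
qed

text \<open>Compare with the threshold \<open>s r\<close>: weight missing on indices up to
  \<open>r\<close> costs at least \<open>s r\<close> per unit, weight beyond \<open>r\<close> gains
  at most \<open>s r\<close> per unit, and the bound on the total weight keeps the gain below the
  loss.\<close>

lemma sum_weighted_le_sum_initial:
  fixes s w :: "nat \<Rightarrow> real"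
  assumes mono: "\<And>i j. 1 \<le> i \<Longrightarrow> i \<le> j \<Longrightarrow> j \<le> m \<Longrightarrow> s j \<le> s i"
    and nonneg: "\<And>i. 1 \<le> i \<Longrightarrow> i \<le> m \<Longrightarrow> 0 \<le> s i"
    and r: "1 \<le> r" "r \<le> m"
    and w: "\<And>i. 0 \<le> w i" "\<And>i. 1 \<le> i \<Longrightarrow> i \<le> m \<Longrightarrow> w i \<le> 1" "(\<Sum>i=1..m. w i) \<le> real r"
  shows "(\<Sum>i=1..m. s i * w i) \<le> (\<Sum>i=1..r. s i)"
proof -
  have split: "(\<Sum>i=1..m. g i) = (\<Sum>i=1..r. g i) + (\<Sum>i=r+1..m. g i)" for g :: "nat \<Rightarrow> real"
    using r sum.ub_add_nat[of 1 r g "m - r"] by simp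
  have "(\<Sum>i=1..r. s r * (1 - w i)) \<le> (\<Sum>i=1..r. s i * (1 - w i))"
    using r w mono by (intro sum_mono mult_right_mono) auto
  moreover have "(\<Sum>i=r+1..m. s i * w i) \<le> (\<Sum>i=r+1..m. s r * w i)"
    using r w mono by (intro sum_mono mult_right_mono) auto
  moreover have "s r * (\<Sum>i=1..m. w i) \<le> s r * real r"
    using r w nonneg by (intro mult_left_mono) auto
  ultimately show ?thesis
    unfolding split by (simp add: algebra_simps sum_subtractf sum_distrib_left)
qed

section \<open>Rank inequalities\<close>

text \<open>Reduces a rank bound to exhibiting a small spanning set for the range, so that sums of
  matrices are handled by unions.\<close>

lemma rank_le_iff_span:
  fixes A :: "real^'n^'m"
  shows "rank A \<le> s \<longleftrightarrow> (\<exists>B. finite B \<and> card B \<le> s \<and> (\<forall>x. A *v x \<in> span B))"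
proof
  assume "rank A \<le> s"
  moreover obtain B where "finite B" "card B = dim (range ((*v) A))" "range ((*v) A) \<subseteq> span B"
    using basis_exists[of "range ((*v) A)"] by (metis independent_imp_finite)
  ultimately show "\<exists>B. finite B \<and> card B \<le> s \<and> (\<forall>x. A *v x \<in> span B)"
    by (auto simp: rank_dim_range intro!: exI[of _ B])
next
  assume "\<exists>B. finite B \<and> card B \<le> s \<and> (\<forall>x. A *v x \<in> span B)"
  then obtain B where "finite B" "card B \<le> s" "range ((*v) A) \<subseteq> span B"
    by auto
  then show "rank A \<le> s"
    using dim_le_card[of "range ((*v) A)" B] by (simp add: rank_dim_range)
qed

lemma rank_add_le:
  fixes A B :: "real^'n^'m"
  assumes "rank A \<le> s" "rank B \<le> t"
  shows "rank (A + B) \<le> s + t"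
proof -
  obtain P Q where P: "finite P" "card P \<le> s" "\<And>x. A *v x \<in> span P"
    and Q: "finite Q" "card Q \<le> t" "\<And>x. B *v x \<in> span Q"
    using assms unfolding rank_le_iff_span by blast
  have "(A + B) *v x \<in> span (P \<union> Q)" for x
    unfolding matrix_vector_mult_add_rdistrib
    by (intro span_add) (meson P(3) Q(3) span_mono subsetD sup_ge1 sup_ge2)+
  moreover have "card (P \<union> Q) \<le> s + t"
    using card_Un_le[of P Q] P(2) Q(2) by linarith
  ultimately show ?thesis
    unfolding rank_le_iff_span using P(1) Q(1) by blast
qed

lemma rank_scaleR_le:
  fixes A :: "real^'n^'m"
  shows "rank (c *\<^sub>R A) \<le> rank A"
proof -
  obtain P where P: "finite P" "card P \<le> rank A" "\<And>x. A *v x \<in> span P"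
    using rank_le_iff_span[of A "rank A"] by blast
  have "(c *\<^sub>R A) *v x \<in> span P" for x
    using span_scale[OF P(3), of c x] by (simp add: scaleR_matrix_vector_assoc)
  then show ?thesis
    unfolding rank_le_iff_span using P by blast
qed

lemma rank_diff_le:
  fixes A B :: "real^'n^'m"
  assumes "rank A \<le> s" "rank B \<le> t"
  shows "rank (A - B) \<le> s + t"
  using rank_add_le[OF assms(1), of "- B" t] rank_scaleR_le[of "-1" B] assms(2) by simp

lemma rank_sum_le:
  fixes f :: "'i \<Rightarrow> real^'n^'m"
  assumes "finite I" "\<And>i. i \<in> I \<Longrightarrow> rank (f i) \<le> 1"
  shows "rank (\<Sum>i\<in>I. f i) \<le> card I"
  using assms
proof (induction I rule: finite_induct)
  case (insert i I)
  then show ?case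
    using rank_add_le[of "f i" 1 "\<Sum>i\<in>I. f i" "card I"] by simp
qed simp

section \<open>Rank-one matrices and the Frobenius inner product\<close>

lemma outer_product_nth: "outer_product u v $ i $ j = u $ i * v $ j"
  by (simp add: outer_product_def matrix_matrix_mult_def columnvector_def rowvector_def)

lemma outer_product_mult_vector: "outer_product u v *v x = (v \<bullet> x) *\<^sub>R u"
  by (simp add: vec_eq_iff matrix_vector_mult_def outer_product_nth inner_vec_def sum_distrib_left
      mult_ac)

lemma transpose_outer_product: "transpose (outer_product u v) = outer_product v u"
  by (simp add: vec_eq_iff transpose_def outer_product_nth)

lemma inner_outer_product: "outer_product u v \<bullet> outer_product u' v' = (u \<bullet> u') * (v \<bullet> v')"
  by (simp add: inner_vec_def outer_product_nth sum_product mult_ac) (rule sum.swap)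

lemma rank_scaled_outer_product_le: "rank (c *\<^sub>R outer_product u v) \<le> 1"
proof -
  have "outer_product u v *v x \<in> span {u}" for x
    unfolding outer_product_mult_vector by (intro span_scale span_base) simp
  then have "rank (outer_product u v) \<le> 1"
    unfolding rank_le_iff_span by (intro exI[of _ "{u}"]) simp
  then show ?thesis
    using rank_scaleR_le[of c "outer_product u v"] by linarith
qed

lemma rank_sum_outer_product_le:
  "finite I \<Longrightarrow> rank (\<Sum>i\<in>I. c i *\<^sub>R outer_product (u i) (v i)) \<le> card I"
  by (rule rank_sum_le[OF _ rank_scaled_outer_product_le])

lemma orthonormal_on_outer_product:
  assumes "orthonormal_on I u" "orthonormal_on I v"
  shows "orthonormal_on I (\<lambda>i. outer_product (u i) (v i))"
  using assms by (auto simp: orthonormal_on_def inner_outer_product)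

text \<open>Bessel's inequality for each column of \<open>W\<close>; the squared lengths of the
  columns add up to the squared Frobenius norm.\<close>

lemma sum_norm_transpose_mult_le:
  fixes W :: "real^'n^'m"
  assumes "orthonormal_on I u" "finite I"
  shows "(\<Sum>i\<in>I. (norm (transpose W *v u i))\<^sup>2) \<le> (norm W)\<^sup>2"
proof -
  have "(\<Sum>i\<in>I. (norm (transpose W *v u i))\<^sup>2)
      = (\<Sum>i\<in>I. \<Sum>j\<in>UNIV. (u i \<bullet> transpose W $ j)\<^sup>2)"
    unfolding power2_norm_eq_inner inner_vec_def[of "transpose W *v _"]
      matrix_vector_mul_component by (simp add: power2_eq_square inner_commute)
  also have "\<dots> = (\<Sum>j\<in>UNIV. \<Sum>i\<in>I. (u i \<bullet> transpose W $ j)\<^sup>2)"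
    by (rule sum.swap)
  also have "\<dots> \<le> (\<Sum>j\<in>UNIV. (norm (transpose W $ j))\<^sup>2)"
    by (intro sum_mono bessel_inequality assms)
  also have "\<dots> = (\<Sum>j\<in>UNIV. \<Sum>i\<in>UNIV. (W $ i $ j)\<^sup>2)"
    unfolding power2_norm_eq_inner inner_vec_def by (simp add: transpose_def power2_eq_square)
  also have "\<dots> = (\<Sum>i\<in>UNIV. \<Sum>j\<in>UNIV. (W $ i $ j)\<^sup>2)"
    by (rule sum.swap)
  also have "\<dots> = (norm W)\<^sup>2"
    unfolding power2_norm_eq_inner inner_vec_def by (simp add: power2_eq_square)
  finally show ?thesis .
qed

section \<open>Singular value decompositions, Eckart-Young, and the two thresholding
  operators\<close>

lemma is_svdD:
  fixes X :: "real^'n^'m"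
  assumes "is_svd X u \<sigma> v"
  shows "orthonormal_on {1..CARD('m)} u" "orthonormal_on {1..CARD('m)} v"
    and "\<And>i. 1 \<le> i \<Longrightarrow> i \<le> CARD('m) \<Longrightarrow> 0 \<le> \<sigma> i"
    and "\<And>i j. 1 \<le> i \<Longrightarrow> i \<le> j \<Longrightarrow> j \<le> CARD('m) \<Longrightarrow> \<sigma> j \<le> \<sigma> i"
    and "X = (\<Sum>i=1..CARD('m). \<sigma> i *\<^sub>R outer_product (u i) (v i))"
  using assms unfolding is_svd_def orthonormal_on_def by auto

text \<open>Test \<open>S - Z\<close> on the left singular vectors: \<open>u i\<close> yields
  \<open>\<sigma> i *\<^sub>R v i\<close> minus a vector of the row space of \<open>Z\<close>, so
  its squared length is at least \<open>(\<sigma> i)\<^sup>2 * (1 - w i)\<close>. The weights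
  \<open>w i\<close> are at most 1 and sum to at most \<open>r\<close>, so they can remove no more
  than the \<open>r\<close> largest squares.\<close>

lemma eckart_young:
  fixes S Z :: "real^'n^'m"
  assumes svd: "is_svd S u \<sigma> v" and r: "1 \<le> r" "r \<le> CARD('m)" and Z: "rank Z \<le> r"
  shows "norm (S - (\<Sum>i=1..r. \<sigma> i *\<^sub>R outer_product (u i) (v i))) \<le> norm (S - Z)"
proof (rule power2_le_imp_le)
  let ?I = "{1..CARD('m)}"
  note s = is_svdD[OF svd]
  let ?E = "\<lambda>i. \<sigma> i *\<^sub>R outer_product (u i) (v i)"
  have split: "(\<Sum>i\<in>?I. g i) = (\<Sum>i=1..r. g i) + (\<Sum>i=r+1..CARD('m). g i)"
    for g :: "nat \<Rightarrow> 'b::comm_monoid_add"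
    using r sum.ub_add_nat[of 1 r g "CARD('m) - r"] by simp
  have tail: "(norm (S - (\<Sum>i=1..r. ?E i)))\<^sup>2 = (\<Sum>i=r+1..CARD('m). (\<sigma> i)\<^sup>2)"
  proof -
    have "S - (\<Sum>i=1..r. ?E i) = (\<Sum>i=r+1..CARD('m). ?E i)"
      using s(5) split[of ?E] by simp
    moreover have "orthonormal_on {r+1..CARD('m)} (\<lambda>i. outer_product (u i) (v i))"
      using orthonormal_on_outer_product[OF s(1,2)] by (auto simp: orthonormal_on_def)
    ultimately show ?thesis
      using orthonormal_on_norm_sum by fastforce
  qed
  obtain B where B: "B \<subseteq> range ((*v) (transpose Z))" "pairwise orthogonal B"
      "\<And>x. x \<in> B \<Longrightarrow> norm x = 1" "independent B" "card B = dim (range ((*v) (transpose Z)))"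
      "span B = range ((*v) (transpose Z))"
    using orthonormal_basis_subspace[of "range ((*v) (transpose Z))"]
    by (metis linear_subspace_image matrix_vector_mul_linear subspace_UNIV)
  have finB: "finite B"
    using B(4) independent_imp_finite by blast
  have cardB: "card B \<le> r"
    using B(5) Z rank_transpose[of Z] by (simp add: rank_dim_range)
  have oB: "orthonormal_on B (\<lambda>b. b)"
    using B(2,3) by (auto simp: orthonormal_on_def pairwise_def orthogonal_def dot_square_norm)
  \<comment> \<open>\<open>w i\<close> is the squared length of the projection of \<open>v i\<close> to the row space of \<open>Z\<close>.\<close>
  define w where "w i = (\<Sum>b\<in>B. (b \<bullet> v i)\<^sup>2)" for i
  have norm_v: "(norm (v i))\<^sup>2 = 1" if "i \<in> ?I" for i
    using orthonormal_onD[OF s(2) that that] by (simp add: power2_norm_eq_inner)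
  have w1: "w i \<le> 1" if "i \<in> ?I" for i
    using bessel_inequality[OF oB finB, of "v i"] norm_v[OF that] by (simp add: w_def)
  \<comment> \<open>Summing over \<open>i\<close> first, Bessel's inequality for the
    \<open>v i\<close> lets each unit vector of \<open>B\<close> contribute at most 1.\<close>
  have wr: "(\<Sum>i\<in>?I. w i) \<le> real r"
  proof -
    have "(\<Sum>i\<in>?I. w i) = (\<Sum>b\<in>B. \<Sum>i\<in>?I. (v i \<bullet> b)\<^sup>2)"
      unfolding w_def by (subst sum.swap) (simp add: inner_commute)
    also have "\<dots> \<le> (\<Sum>b\<in>B. (norm b)\<^sup>2)"
      by (intro sum_mono bessel_inequality s(2)) simp
    also have "\<dots> = real (card B)"
      using B(3) by simp
    finally show ?thesis
      using cardB by simp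
  qed
  have "(\<sigma> i)\<^sup>2 * (1 - w i) \<le> (norm (transpose (S - Z) *v u i))\<^sup>2" if i: "i \<in> ?I" for i
  proof -
    have "transpose S *v u i = (\<Sum>j\<in>?I. (\<sigma> j * (u j \<bullet> u i)) *\<^sub>R v j)"
    proof -
      have "transpose S = (\<Sum>j\<in>?I. \<sigma> j *\<^sub>R outer_product (v j) (u j))"
        by (subst s(5)) (simp add: vec_eq_iff transpose_def outer_product_nth mult_ac)
      then show ?thesis
        by (simp add: vec_eq_iff matrix_vector_mult_def outer_product_nth inner_vec_def
            sum_distrib_left sum_distrib_right mult_ac) (subst sum.swap, simp)
    qed
    also have "\<dots> = (\<Sum>j\<in>?I. if i = j then \<sigma> j *\<^sub>R v j else 0)"
      using i by (intro sum.cong) (auto simp: orthonormal_onD[OF s(1)])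
    also have "\<dots> = \<sigma> i *\<^sub>R v i"
      using i by simp
    finally have Su: "transpose (S - Z) *v u i = \<sigma> i *\<^sub>R v i - transpose Z *v u i"
      by (simp add: transpose_def vec_eq_iff matrix_vector_mult_def sum_subtractf algebra_simps)
    have "(norm (\<sigma> i *\<^sub>R v i))\<^sup>2 - (\<Sum>b\<in>B. (b \<bullet> (\<sigma> i *\<^sub>R v i))\<^sup>2)
        \<le> (norm (\<sigma> i *\<^sub>R v i - transpose Z *v u i))\<^sup>2"
      by (rule orthonormal_on_norm_residual_le[OF oB finB]) (simp add: B(6))
    then show ?thesis
      unfolding Su w_def using norm_v[OF i]
      by (simp add: power_mult_distrib sum_distrib_left[symmetric] algebra_simps)
  qed
  then have "(\<Sum>i\<in>?I. (\<sigma> i)\<^sup>2 * (1 - w i)) \<le> (\<Sum>i\<in>?I. (norm (transpose (S - Z) *v u i))\<^sup>2)"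
    by (rule sum_mono)
  also have "\<dots> \<le> (norm (S - Z))\<^sup>2"
    by (rule sum_norm_transpose_mult_le[OF s(1)]) simp
  finally have "(\<Sum>i\<in>?I. (\<sigma> i)\<^sup>2 * (1 - w i)) \<le> (norm (S - Z))\<^sup>2" .
  moreover have "(\<Sum>i\<in>?I. (\<sigma> i)\<^sup>2 * w i) \<le> (\<Sum>i=1..r. (\<sigma> i)\<^sup>2)"
    using r wr w1 s(3,4)
    by (intro sum_weighted_le_sum_initial) (auto simp: w_def sum_nonneg intro!: power_mono)
  ultimately show "(norm (S - (\<Sum>i=1..r. ?E i)))\<^sup>2 \<le> (norm (S - Z))\<^sup>2"
    unfolding tail using split[of "\<lambda>i. (\<sigma> i)\<^sup>2"] by (simp add: algebra_simps sum_subtractf)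
qed simp

text \<open>Expand the square of \<open>s - b = (s - a) + (a - b)\<close>. This turns optimality of
  the truncation into an inner product estimate in which \<open>a - s\<close> can be split
  further.\<close>

lemma inner_le_if_norm_le:
  fixes a b s :: "'a::real_inner"
  assumes "norm (s - b) \<le> norm (s - a)"
  shows "(norm (a - b))\<^sup>2 \<le> 2 * ((a - b) \<bullet> (a - s))"
proof -
  have "(norm (s - b))\<^sup>2 \<le> (norm (s - a))\<^sup>2"
    using assms by (intro power_mono) auto
  then show ?thesis
    by (simp add: power2_norm_eq_inner inner_diff_left inner_diff_right inner_commute)
qed

lemma norm_diff_best_rank_approx_le:
  fixes S Z R :: "real^'n^'m"
  assumes "is_best_rank_approx r S R" "1 \<le> r" "r \<le> CARD('m)" "rank Z \<le> r"
  shows "norm (S - R) \<le> norm (S - Z)"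
  using assms eckart_young unfolding is_best_rank_approx_def by blast

lemma rank_best_rank_approx_le:
  fixes S R :: "real^'n^'m"
  assumes "is_best_rank_approx r S R"
  shows "rank R \<le> r"
  using assms rank_sum_outer_product_le[of "{1..r}"] unfolding is_best_rank_approx_def by fastforce

text \<open>Each singular value drops by the smaller of itself and \<open>\<mu>\<close>, and the
  \<open>CARD('m)\<close> rank-one terms are orthonormal.\<close>

lemma norm_diff_shrinkage_le:
  fixes Y S :: "real^'n^'m"
  assumes "is_shrinkage \<mu> Y S" "0 \<le> \<mu>"
  shows "norm (Y - S) \<le> \<mu> * sqrt (real CARD('m))"
proof -
  let ?I = "{1..CARD('m)}"
  obtain u \<sigma> v where svd: "is_svd Y u \<sigma> v"
    and S: "S = (\<Sum>i\<in>?I. max (\<sigma> i - \<mu>) 0 *\<^sub>R outer_product (u i) (v i))"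
    using assms(1) unfolding is_shrinkage_def by blast
  note s = is_svdD[OF svd]
  have "Y - S = (\<Sum>i\<in>?I. (\<sigma> i - max (\<sigma> i - \<mu>) 0) *\<^sub>R outer_product (u i) (v i))"
    unfolding S by (subst s(5)) (simp add: sum_subtractf scaleR_diff_left)
  then have "(norm (Y - S))\<^sup>2 = (\<Sum>i\<in>?I. (\<sigma> i - max (\<sigma> i - \<mu>) 0)\<^sup>2)"
    using orthonormal_on_norm_sum[OF orthonormal_on_outer_product[OF s(1,2)]] by simp
  also have "\<dots> \<le> (\<Sum>i\<in>?I. \<mu>\<^sup>2)"
    using s(3) assms(2) by (intro sum_mono power_mono) auto
  also have "\<dots> = (\<mu> * sqrt (real CARD('m)))\<^sup>2"
    by (simp add: power_mult_distrib)
  finally show ?thesis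
    by (rule power2_le_imp_le) (use assms(2) in auto)
qed

text \<open>Without a singular value decomposition of its argument, \<open>nuclear_norm\<close> would be a junk value.\<close>

lemma is_svd_truncation_residual:
  fixes X :: "real^'n^'m"
  assumes "is_best_rank_approx r X R" "r \<le> CARD('m)"
  shows "\<exists>u \<sigma> v. is_svd (X - R) u \<sigma> v"
proof -
  let ?m = "CARD('m)"
  obtain u \<sigma> v where svd: "is_svd X u \<sigma> v"
    and R: "R = (\<Sum>i=1..r. \<sigma> i *\<^sub>R outer_product (u i) (v i))"
    using assms(1) unfolding is_best_rank_approx_def by blast
  note s = is_svdD[OF svd]
  \<comment> \<open>Cyclic shift by \<open>r\<close>: the tail moves to the front, and the singular
    vectors removed with \<open>R\<close> return at the end, with singular value 0, to complete the
    orthonormal families.\<close>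
  define p where "p i = (if i \<le> ?m - r then i + r else i - (?m - r))" for i
  define \<tau> where "\<tau> i = (if i \<le> ?m - r then \<sigma> (i + r) else 0)" for i
  have p: "p i \<in> {1..?m}" "p i = p j \<longleftrightarrow> i = j" if "i \<in> {1..?m}" "j \<in> {1..?m}" for i j
    using that assms(2) by (auto simp: p_def)
  have split: "(\<Sum>i=1..?m. g i) = (\<Sum>i=1..r. g i) + (\<Sum>i=r+1..?m. g i)"
    for g :: "nat \<Rightarrow> real^'n^'m"
    using assms(2) sum.ub_add_nat[of 1 r g "?m - r"] by simp
  have "X - R = (\<Sum>i=1+r..(?m-r)+r. \<sigma> i *\<^sub>R outer_product (u i) (v i))"
    unfolding R using s(5) split[of "\<lambda>i. \<sigma> i *\<^sub>R outer_product (u i) (v i)"] assms(2) by simp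
  also have "\<dots> = (\<Sum>i=1..?m-r. \<sigma> (i + r) *\<^sub>R outer_product (u (i + r)) (v (i + r)))"
    by (rule sum.shift_bounds_cl_nat_ivl)
  also have "\<dots> = (\<Sum>i=1..?m. \<tau> i *\<^sub>R outer_product (u (p i)) (v (p i)))"
    by (rule sum.mono_neutral_cong_left) (auto simp: \<tau>_def p_def)
  finally have "X - R = (\<Sum>i=1..?m. \<tau> i *\<^sub>R outer_product (u (p i)) (v (p i)))" .
  moreover have "u (p i) \<bullet> u (p j) = (if i = j then 1 else 0)"
    "v (p i) \<bullet> v (p j) = (if i = j then 1 else 0)" if "i \<in> {1..?m}" "j \<in> {1..?m}" for i j
    using p[OF that] p[OF that(2,1)] orthonormal_onD[OF s(1)] orthonormal_onD[OF s(2)] by auto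
  moreover have "0 \<le> \<tau> i" "i \<le> j \<longrightarrow> \<tau> j \<le> \<tau> i" if "i \<in> {1..?m}" "j \<in> {1..?m}" for i j
    using s(3,4) that by (auto simp: \<tau>_def)
  ultimately have "is_svd (X - R) (\<lambda>i. u (p i)) \<tau> (\<lambda>i. v (p i))"
    unfolding is_svd_def by blast
  then show ?thesis
    by blast
qed

lemma is_svd_singular_values:
  assumes "\<exists>u \<sigma> v. is_svd W u \<sigma> v"
  shows "\<exists>u v. is_svd W u (singular_values W) v"
proof -
  have "\<exists>\<sigma> u v. is_svd W u \<sigma> v"
    using assms by blast
  then show ?thesis
    unfolding singular_values_def by (rule someI_ex)
qed

section \<open>Restricted isometry and its consequences\<close>

text \<open>The predicate minimised in \<open>ric\<close>; naming it allows work with any upper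
  bound of the constant.\<close>

definition restricted_isometry :: "(real^'n^'m \<Rightarrow> real^'p) \<Rightarrow> nat \<Rightarrow> real \<Rightarrow> bool" where
  "restricted_isometry \<A> s \<delta> \<longleftrightarrow> (\<forall>X. rank X \<le> s \<longrightarrow>
     (1 - \<delta>) * (norm X)\<^sup>2 \<le> (norm (\<A> X))\<^sup>2 \<and> (norm (\<A> X))\<^sup>2 \<le> (1 + \<delta>) * (norm X)\<^sup>2)"

lemma restricted_isometry_mono:
  fixes \<A> :: "real^'n^'m \<Rightarrow> real^'p"
  assumes "restricted_isometry \<A> s \<delta>" "\<delta> \<le> \<delta>'" "t \<le> s"
  shows "restricted_isometry \<A> t \<delta>'"
  unfolding restricted_isometry_def
proof (intro allI impI)
  fix X :: "real^'n^'m"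
  assume "rank X \<le> t"
  then have "(1 - \<delta>) * (norm X)\<^sup>2 \<le> (norm (\<A> X))\<^sup>2" "(norm (\<A> X))\<^sup>2 \<le> (1 + \<delta>) * (norm X)\<^sup>2"
    using assms(1,3) unfolding restricted_isometry_def by auto
  moreover have "\<delta> * (norm X)\<^sup>2 \<le> \<delta>' * (norm X)\<^sup>2"
    using assms(2) by (intro mult_right_mono) auto
  ultimately show "(1 - \<delta>') * (norm X)\<^sup>2 \<le> (norm (\<A> X))\<^sup>2 \<and> (norm (\<A> X))\<^sup>2 \<le> (1 + \<delta>') * (norm X)\<^sup>2"
    by (simp add: algebra_simps)
qed

text \<open>\<open>LEAST\<close> on the reals yields the property only if a minimum exists. The
  admissible constants form a nonempty closed set bounded below, so their infimum is
  attained.\<close>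

lemma restricted_isometry_ric:
  fixes \<A> :: "real^'n^'m \<Rightarrow> real^'p"
  assumes "linear \<A>" "1 \<le> s"
  shows "restricted_isometry \<A> s (ric \<A> s)"
proof -
  let ?D = "{\<delta>. restricted_isometry \<A> s \<delta>}"
  obtain K where K: "\<And>X. norm (\<A> X) \<le> norm X * K" "0 < K"
    using bounded_linear.pos_bounded[of \<A>] assms(1) by (auto simp: linear_conv_bounded_linear)
  \<comment> \<open>With this constant the lower inequality has a nonpositive left side, and the
    upper one follows from the operator bound \<open>K\<close>.\<close>
  have "restricted_isometry \<A> s (1 + K\<^sup>2)"
    unfolding restricted_isometry_def
  proof (intro allI impI conjI)
    fix X :: "real^'n^'m"
    have "(norm (\<A> X))\<^sup>2 \<le> (norm X * K)\<^sup>2"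
      using K by (intro power_mono) auto
    also have "\<dots> \<le> (1 + (1 + K\<^sup>2)) * (norm X)\<^sup>2"
      by (simp add: power_mult_distrib algebra_simps)
    finally show "(norm (\<A> X))\<^sup>2 \<le> (1 + (1 + K\<^sup>2)) * (norm X)\<^sup>2" .
    have "(1 - (1 + K\<^sup>2)) * (norm X)\<^sup>2 \<le> 0"
      by simp
    then show "(1 - (1 + K\<^sup>2)) * (norm X)\<^sup>2 \<le> (norm (\<A> X))\<^sup>2"
      by (rule order_trans) simp
  qed
  then have ne: "?D \<noteq> {}"
    by auto
  have "0 \<le> \<delta>" if "restricted_isometry \<A> s \<delta>" for \<delta>
  proof -
    \<comment> \<open>One nonzero matrix of rank at most \<open>s\<close> forces the sign of
      \<open>\<delta>\<close>; \<open>undefined\<close> merely names some index.\<close>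
    let ?u = "axis undefined 1 :: real^'m" and ?v = "axis undefined 1 :: real^'n"
    let ?X = "outer_product ?u ?v"
    have "rank ?X \<le> s"
      using rank_scaled_outer_product_le[of 1 ?u ?v] assms(2) by simp
    then have "(1 - \<delta>) * (norm ?X)\<^sup>2 \<le> (1 + \<delta>) * (norm ?X)\<^sup>2"
      using that unfolding restricted_isometry_def by (meson order_trans)
    moreover have "(norm ?X)\<^sup>2 = 1"
      by (simp add: power2_norm_eq_inner inner_outer_product inner_axis)
    ultimately show ?thesis
      by simp
  qed
  then have bdd: "bdd_below ?D"
    by (auto simp: bdd_below_def)
  have "closed ?D"
    unfolding restricted_isometry_def
    by (intro closed_Collect_all closed_Collect_imp open_Collect_const closed_Collect_conj
        closed_Collect_le continuous_intros)
  then have "Inf ?D \<in> ?D"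
    by (rule closed_contains_Inf[OF ne bdd])
  moreover have "(LEAST \<delta>. restricted_isometry \<A> s \<delta>) = Inf ?D"
    using calculation cInf_lower[OF _ bdd] by (intro Least_equality) simp_all
  ultimately show ?thesis
    by (simp add: ric_def restricted_isometry_def[symmetric, abs_def])
qed

lemma restricted_isometry_norm_le:
  assumes "restricted_isometry \<A> s \<delta>" "rank X \<le> s"
  shows "norm (\<A> X) \<le> sqrt (1 + \<delta>) * norm X"
proof -
  have "(norm (\<A> X))\<^sup>2 \<le> (1 + \<delta>) * (norm X)\<^sup>2"
    using assms unfolding restricted_isometry_def by blast
  then show ?thesis
    using real_le_rsqrt by (fastforce simp: real_sqrt_mult)
qed

text \<open>Nearly preserved norms give nearly preserved inner products. The rank hypothesis covers
  all combinations because \<open>D\<close> and \<open>Z\<close> are rescaled before they are added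
  and subtracted.\<close>

lemma restricted_isometry_inner_le:
  fixes \<A> :: "real^'n^'m \<Rightarrow> real^'p"
  assumes "linear \<A>" "restricted_isometry \<A> s \<delta>"
    and rank: "\<And>a b. rank (a *\<^sub>R D + b *\<^sub>R Z) \<le> s"
  shows "D \<bullet> Z - \<A> D \<bullet> \<A> Z \<le> \<delta> * norm D * norm Z"
proof (cases "D = 0 \<or> Z = 0")
  case True
  then show ?thesis
    using linear_0[OF assms(1)] by auto
next
  case False
  interpret linear \<A> by fact
  \<comment> \<open>polarization, with unit vectors so that both signs of \<open>P \<plusminus> Q\<close> give the constant \<open>\<delta>\<close>\<close>
  define P Q where "P = (1 / norm D) *\<^sub>R D" and "Q = (1 / norm Z) *\<^sub>R Z"
  have PQ: "P \<bullet> P = 1" "Q \<bullet> Q = 1"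
    using False by (auto simp: P_def Q_def dot_square_norm power2_eq_square)
  have "rank (P + Q) \<le> s" "rank (P - Q) \<le> s"
    using rank[of "1 / norm D" "1 / norm Z"] rank[of "1 / norm D" "- (1 / norm Z)"]
    by (simp_all add: P_def Q_def)
  then have "(1 - \<delta>) * (norm (P + Q))\<^sup>2 \<le> (norm (\<A> (P + Q)))\<^sup>2"
    "(norm (\<A> (P - Q)))\<^sup>2 \<le> (1 + \<delta>) * (norm (P - Q))\<^sup>2"
    using assms(2) unfolding restricted_isometry_def by blast+
  then have "P \<bullet> Q - \<A> P \<bullet> \<A> Q \<le> \<delta>"
    using PQ by (simp add: power2_norm_eq_inner add diff inner_diff_left inner_diff_right
        inner_add_left inner_add_right inner_commute algebra_simps)
  moreover have "D \<bullet> Z - \<A> D \<bullet> \<A> Z = (P \<bullet> Q - \<A> P \<bullet> \<A> Q) * (norm D * norm Z)"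
    using False by (simp add: P_def Q_def scale field_simps)
  ultimately show ?thesis
    using mult_right_mono[of "P \<bullet> Q - \<A> P \<bullet> \<A> Q" \<delta> "norm D * norm Z"] by simp
qed

text \<open>\<open>W\<close> may have large rank, so the isometry bound is applied to blocks of
  \<open>r\<close> singular values. The first block costs at most \<open>norm W\<close>; each later
  one is charged to the singular values of its predecessor, and these charges add up to the second
  term.\<close>

lemma restricted_isometry_norm_le_nuclear:
  fixes \<A> :: "real^'n^'m \<Rightarrow> real^'p" and W :: "real^'n^'m"
  assumes "linear \<A>" "restricted_isometry \<A> r \<delta>" "0 \<le> 1 + \<delta>" "1 \<le> r" "is_svd W u \<sigma> v"
  shows "norm (\<A> W) \<le> sqrt (1 + \<delta>) * (norm W + 1 / sqrt (real r) * (\<Sum>i=1..CARD('m). \<sigma> i))"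
proof -
  interpret linear \<A> by fact
  let ?m = "CARD('m)"
  note svd = is_svdD[OF assms(5)]
  \<comment> \<open>Zero-based and padded with zeros, so that \<open>CARD('m)\<close> blocks of
    length \<open>r\<close> cover all singular values even if \<open>r\<close> does not divide
    \<open>CARD('m)\<close>.\<close>
  define s where "s i = (if i < ?m then \<sigma> (Suc i) else 0)" for i
  define E where "E i = outer_product (u (Suc i)) (v (Suc i))" for i
  define B where "B j = (\<Sum>i\<in>{j*r..<j*r+r}. s i *\<^sub>R E i)" for j
  have s_nonneg: "0 \<le> s i" for i
    using svd(3) by (auto simp: s_def)
  have s_mono: "s j \<le> s i" if "i \<le> j" for i j
    using svd(3,4) that by (auto simp: s_def)
  have E: "orthonormal_on {..<?m} E"
    using orthonormal_on_outer_product[OF svd(1,2)] by (auto simp: orthonormal_on_def E_def)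
  have norm_sum: "(norm (\<Sum>i\<in>I. s i *\<^sub>R E i))\<^sup>2 = (\<Sum>i\<in>I. (s i)\<^sup>2)" if "finite I" for I
  proof -
    have "(\<Sum>i\<in>I. s i *\<^sub>R E i) = (\<Sum>i\<in>I \<inter> {..<?m}. s i *\<^sub>R E i)"
      using that by (intro sum.mono_neutral_right) (auto simp: s_def)
    moreover have "(\<Sum>i\<in>I. (s i)\<^sup>2) = (\<Sum>i\<in>I \<inter> {..<?m}. (s i)\<^sup>2)"
      using that by (intro sum.mono_neutral_right) (auto simp: s_def)
    moreover have "orthonormal_on (I \<inter> {..<?m}) E"
      using E by (auto simp: orthonormal_on_def)
    ultimately show ?thesis
      using orthonormal_on_norm_sum[of "I \<inter> {..<?m}" E s] by simp
  qed
  have m_le: "?m \<le> ?m * r"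
    using assms(4) by simp
  have sum_s: "(\<Sum>i<?m*r. s i) = (\<Sum>i=1..?m. \<sigma> i)"
  proof -
    have "(\<Sum>i<?m*r. s i) = (\<Sum>i<?m. s i)"
      using m_le by (intro sum.mono_neutral_right) (auto simp: s_def)
    also have "\<dots> = (\<Sum>i=1..?m. \<sigma> i)"
      by (simp add: s_def sum.atLeast1_atMost_eq)
    finally show ?thesis .
  qed
  have W: "W = (\<Sum>i<?m*r. s i *\<^sub>R E i)"
  proof -
    have "(\<Sum>i<?m*r. s i *\<^sub>R E i) = (\<Sum>i<?m. s i *\<^sub>R E i)"
      using m_le by (intro sum.mono_neutral_right) (auto simp: s_def)
    also have "\<dots> = W"
      by (subst svd(5)) (simp add: s_def E_def sum.atLeast1_atMost_eq)
    finally show ?thesis ..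
  qed
  have W_blocks: "W = (\<Sum>j<?m. B j)"
    unfolding W B_def by (rule sum.nat_group[symmetric])
  have first: "norm (B 0) \<le> norm W"
  proof (rule power2_le_imp_le)
    have "(\<Sum>i\<in>{0*r..<0*r+r}. (s i)\<^sup>2) \<le> (\<Sum>i<?m*r. (s i)\<^sup>2)"
      by (intro sum_mono2) (auto intro: less_le_trans)
    then show "(norm (B 0))\<^sup>2 \<le> (norm W)\<^sup>2"
      unfolding B_def W by (simp only: norm_sum finite_lessThan finite_atLeastLessThan)
  qed simp
  \<comment> \<open>Every singular value of a block is at most the average of the preceding block.\<close>
  have later: "norm (B (Suc j)) \<le> 1 / sqrt (real r) * (\<Sum>i\<in>{j*r..<j*r+r}. s i)" for j
  proof -
    let ?t = "s (Suc j * r)"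
    have "(norm (B (Suc j)))\<^sup>2 = (\<Sum>i\<in>{Suc j*r..<Suc j*r+r}. (s i)\<^sup>2)"
      unfolding B_def by (rule norm_sum) simp
    also have "\<dots> \<le> (\<Sum>i\<in>{Suc j*r..<Suc j*r+r}. ?t\<^sup>2)"
      using s_mono s_nonneg by (intro sum_mono power_mono) auto
    also have "\<dots> = (sqrt (real r) * ?t)\<^sup>2"
      by (simp add: power_mult_distrib)
    finally have "norm (B (Suc j)) \<le> sqrt (real r) * ?t"
      by (rule power2_le_imp_le) (simp add: s_nonneg)
    also have "\<dots> = 1 / sqrt (real r) * (real r * ?t)"
      using assms(4) by (simp add: field_simps)
    also have "real r * ?t = (\<Sum>i\<in>{j*r..<j*r+r}. ?t)"
      by simp
    also have "1 / sqrt (real r) * \<dots> \<le> 1 / sqrt (real r) * (\<Sum>i\<in>{j*r..<j*r+r}. s i)"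
      using s_mono by (intro mult_left_mono sum_mono) auto
    finally show ?thesis .
  qed
  have "rank (B j) \<le> r" for j
    using rank_sum_outer_product_le[of "{j*r..<j*r+r}" s "\<lambda>i. u (Suc i)" "\<lambda>i. v (Suc i)"]
    by (simp add: B_def E_def)
  then have "norm (\<A> (B j)) \<le> sqrt (1 + \<delta>) * norm (B j)" for j
    by (rule restricted_isometry_norm_le[OF assms(2)])
  then have "norm (\<A> W) \<le> (\<Sum>j<?m. sqrt (1 + \<delta>) * norm (B j))"
    unfolding W_blocks sum by (intro sum_norm_le)
  also have "\<dots> = sqrt (1 + \<delta>) * (\<Sum>j<?m. norm (B j))"
    by (simp add: sum_distrib_left)
  also have "\<dots> \<le> sqrt (1 + \<delta>) * (norm W + 1 / sqrt (real r) * (\<Sum>i=1..?m. \<sigma> i))"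
  proof (rule mult_left_mono)
    obtain k where k: "?m = Suc k"
      using not0_implies_Suc by (metis zero_less_card_finite less_irrefl)
    have "(\<Sum>j<?m. norm (B j)) = norm (B 0) + (\<Sum>j<k. norm (B (Suc j)))"
      unfolding k by (rule sum.lessThan_Suc_shift)
    also have "\<dots> \<le> norm W + (\<Sum>j<k. 1 / sqrt (real r) * (\<Sum>i\<in>{j*r..<j*r+r}. s i))"
      by (intro add_mono first sum_mono later)
    \<comment> \<open>The later blocks are charged to all block sums but the last; adding that
      nonnegative sum completes the sum of all singular values.\<close>
    also have "\<dots> \<le> norm W + (\<Sum>j<?m. 1 / sqrt (real r) * (\<Sum>i\<in>{j*r..<j*r+r}. s i))"
      unfolding k
      by (intro add_left_mono sum_mono2) (auto intro!: sum_nonneg divide_nonneg_nonneg s_nonneg)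
    also have "\<dots> = norm W + 1 / sqrt (real r) * (\<Sum>i=1..?m. \<sigma> i)"
      by (simp only: sum_distrib_left[symmetric] sum.nat_group sum_s)
    finally show "(\<Sum>j<?m. norm (B j)) \<le> norm W + 1 / sqrt (real r) * (\<Sum>i=1..?m. \<sigma> i)" .
  qed (use assms(3) in simp)
  finally show ?thesis .
qed

section \<open>The iteration and its error recurrence\<close>

text \<open>Here \<open>e\<close> is the effective noise relative to \<open>R\<close>, instantiated
  later by \<open>e'\<close> and \<open>Xr\<close>. Every term of the bound on the squared norm of
  \<open>R - Q\<close> carries a factor \<open>norm (R - Q)\<close>, which is cancelled at the end;
  hence the separate case \<open>R = Q\<close>.\<close>

lemma IHTMS_step:
  fixes \<A> :: "real^'n^'m \<Rightarrow> real^'p"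
  assumes "linear \<A>" "restricted_isometry \<A> (3 * r) \<delta>" "0 \<le> \<delta>" "1 \<le> r" "r \<le> CARD('m)" "0 \<le> \<mu>"
    and rank: "rank R \<le> r" "rank P \<le> r"
    and shrink: "is_shrinkage \<mu> (P - adjoint \<A> (\<A> P - (\<A> R + e))) S"
    and approx: "is_best_rank_approx r S Q"
  shows "norm (R - Q) \<le>
    2 * \<delta> * norm (R - P) + 2 * sqrt (1 + \<delta>) * norm e + 2 * \<mu> * sqrt (real CARD('m))"
proof (cases "R = Q")
  case True
  then show ?thesis
    using assms(3,6) by simp
next
  case False
  interpret linear \<A> by fact
  define Y where "Y = P - adjoint \<A> (\<A> P - (\<A> R + e))"
  let ?D = "R - Q" and ?Z = "R - P"
  have rank_Q: "rank Q \<le> r"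
    by (rule rank_best_rank_approx_le[OF approx])
  have rank_DZ: "rank (a *\<^sub>R ?D + b *\<^sub>R ?Z) \<le> 3 * r" for a b
  proof -
    have scaled: "rank (c *\<^sub>R M) \<le> r" if "rank M \<le> r" for c and M :: "real^'n^'m"
      using rank_scaleR_le[of c M] that by linarith
    \<comment> \<open>Regrouping by the three matrices gives \<open>3 * r\<close>; adding the ranks
      of the two differences would give only \<open>4 * r\<close>.\<close>
    have "rank ((a + b) *\<^sub>R R - a *\<^sub>R Q - b *\<^sub>R P) \<le> r + r + r"
      by (intro rank_diff_le scaled rank rank_Q)
    then show ?thesis
      by (simp add: algebra_simps)
  qed
  \<comment> \<open>Since \<open>R - Y = ?Z - adjoint \<A> (\<A> ?Z + e)\<close>, moving the adjoint
    onto \<open>?D\<close> leaves the defect of the isometry and a noise term.\<close>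
  have "?D \<bullet> (R - Y) = (?D \<bullet> ?Z - \<A> ?D \<bullet> \<A> ?Z) - \<A> ?D \<bullet> e"
    by (simp add: Y_def inner_diff_right inner_add_right adjoint_works[OF assms(1)] diff
        algebra_simps)
  moreover have "?D \<bullet> ?Z - \<A> ?D \<bullet> \<A> ?Z \<le> \<delta> * norm ?D * norm ?Z"
    by (rule restricted_isometry_inner_le[OF assms(1,2) rank_DZ])
  moreover have "- (\<A> ?D \<bullet> e) \<le> sqrt (1 + \<delta>) * norm ?D * norm e"
  proof -
    have "- (\<A> ?D \<bullet> e) \<le> norm (\<A> ?D) * norm e"
      using Cauchy_Schwarz_ineq2[of "\<A> ?D" e] by linarith
    also have "\<dots> \<le> sqrt (1 + \<delta>) * norm ?D * norm e"
      using restricted_isometry_norm_le[OF assms(2), of ?D] rank_DZ[of 1 0]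
      by (intro mult_right_mono) auto
    finally show ?thesis .
  qed
  moreover have "?D \<bullet> (Y - S) \<le> norm ?D * (\<mu> * sqrt (real CARD('m)))"
  proof -
    have "?D \<bullet> (Y - S) \<le> norm ?D * norm (Y - S)"
      by (rule norm_cauchy_schwarz)
    also have "\<dots> \<le> norm ?D * (\<mu> * sqrt (real CARD('m)))"
      using norm_diff_shrinkage_le[OF shrink assms(6)] by (intro mult_left_mono) (auto simp: Y_def)
    finally show ?thesis .
  qed
  moreover have "(norm ?D)\<^sup>2 \<le> 2 * (?D \<bullet> (R - S))"
    by (rule inner_le_if_norm_le[OF norm_diff_best_rank_approx_le[OF approx assms(4,5) rank(1)]])
  moreover have "?D \<bullet> (R - S) = ?D \<bullet> (R - Y) + ?D \<bullet> (Y - S)"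
    by (simp add: inner_diff_right)
  ultimately have "norm ?D * norm ?D \<le> norm ?D *
      (2 * \<delta> * norm ?Z + 2 * sqrt (1 + \<delta>) * norm e + 2 * \<mu> * sqrt (real CARD('m)))"
    by (simp add: power2_eq_square algebra_simps)
  then show ?thesis
    using False by (simp add: mult_le_cancel_left)
qed

text \<open>The constant \<open>c / (1 - a)\<close> is the fixed point of the recurrence, so it
  reproduces itself in the induction step.\<close>

lemma linear_recurrence_bound:
  fixes z :: "nat \<Rightarrow> real"
  assumes "\<And>k. z (Suc k) \<le> a * z k + c" "0 \<le> a" "a < 1" "0 \<le> c"
  shows "z k \<le> a ^ k * z 0 + c / (1 - a)"
proof (induction k)
  case 0
  then show ?case
    using assms by simp
next
  case (Suc k)
  have "z (Suc k) \<le> a * (a ^ k * z 0 + c / (1 - a)) + c"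
    using assms(1)[of k] mult_left_mono[OF Suc assms(2)] by linarith
  also have "\<dots> = a ^ Suc k * z 0 + c / (1 - a)"
    using assms(3) by (simp add: field_simps)
  finally show ?case .
qed

lemma power_mult_le_if_ceiling_log:
  fixes a x y :: real
  assumes "0 < a" "a < 1" "0 \<le> x" "0 < y" "k = nat \<lceil>log (1 / a) (x / y)\<rceil>"
  shows "a ^ k * x \<le> y"
proof (cases "x = 0")
  case True
  then show ?thesis
    using assms by simp
next
  case False
  have "log (1 / a) (x / y) \<le> real k"
    unfolding assms(5) by linarith
  then have "x / y \<le> (1 / a) powr real k"
    using assms False by (subst (asm) log_le_iff) auto
  then show ?thesis
    using assms by (simp add: powr_realpow field_simps)
qed

theorem theorem5p2:
  fixes \<A> :: "real^'n^'m \<Rightarrow> real^'p"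
    and X Xr X0 :: "real^'n^'m"
    and Xs :: "nat \<Rightarrow> real^'n^'m"
    and b e :: "real^'p"
    and r :: nat
    and \<alpha> \<beta> \<gamma> \<epsilon> \<mu> :: real
  assumes "CARD('m) \<le> CARD('n)"
    and "linear \<A>"
    and "b = \<A> X + e"
    and "1 \<le> r" and "3 * r \<le> CARD('m)"
    and "0 < \<alpha>" and "\<alpha> < 1"
    and "ric \<A> (3 * r) \<le> \<alpha> / sqrt 8"
    and "is_best_rank_approx r X Xr"
    and "0 < \<mu>"
    and "rank X0 \<le> r"
    and "is_IHTMS \<A> b r \<mu> X0 Xs"
    and "\<beta> = 2 * sqrt (1 + \<alpha> / sqrt 8)"
    and "\<gamma> = \<beta>\<^sup>2 / (2 * (1 - \<alpha>)) + 1"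
    and "\<epsilon> = norm (X - Xr) + 1 / sqrt (real r) * nuclear_norm (X - Xr) + norm e"
  shows "(\<forall>k. norm (X - Xs k) \<le>
            \<alpha> ^ k * norm (Xr - X0) + \<gamma> * \<epsilon> + 2 * \<mu> * sqrt (real CARD('m)) / (1 - \<alpha>)) \<and>
         (\<forall>k. k = nat \<lceil>log (1 / \<alpha>) (norm (Xr - X0) / (\<epsilon> + 2 * \<mu> * sqrt (real CARD('m))))\<rceil> \<longrightarrow>
            norm (X - Xs k) \<le>
              (1 + \<gamma>) * \<epsilon> + (2 - \<alpha>) / (1 - \<alpha>) * (2 * \<mu> * sqrt (real CARD('m))))"
proof -
  define d where "d = \<alpha> / sqrt 8"
  define M where "M = 2 * \<mu> * sqrt (real CARD('m))"
  define e' where "e' = \<A> (X - Xr) + e"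
  interpret linear \<A> by fact
  have r: "r \<le> CARD('m)"
    using assms(5) by simp
  \<comment> \<open>The step lemma contracts by \<open>2 * d\<close>, and \<open>sqrt 8\<close> is
    at least 2.\<close>
  have d: "0 < d" "2 * d \<le> \<alpha>"
    using assms(6) real_le_rsqrt[of 2 8] by (auto simp: d_def field_simps)
  have rip: "restricted_isometry \<A> (3 * r) d"
    unfolding d_def
    by (rule restricted_isometry_mono[OF restricted_isometry_ric[OF assms(2)] assms(8) order_refl])
       (use assms(4) in simp)
  have \<beta>: "\<beta>\<^sup>2 = 4 * (1 + d)"
    using d assms(13) by (simp add: d_def power_mult_distrib)
  obtain u v where svd: "is_svd (X - Xr) u (singular_values (X - Xr)) v"
    using is_svd_singular_values[OF is_svd_truncation_residual[OF assms(9) r]] by blast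
  have nuclear: "0 \<le> nuclear_norm (X - Xr)"
    unfolding nuclear_norm_def using is_svdD(3)[OF svd] by (intro sum_nonneg) auto
  have \<epsilon>: "norm (X - Xr) \<le> \<epsilon>" "0 \<le> \<epsilon>"
    using nuclear assms(15) by auto
  have M: "0 < M"
    using assms(10) by (simp add: M_def)
  have b: "b = \<A> Xr + e'"
    by (simp add: assms(3) e'_def diff)
  \<comment> \<open>One factor \<open>sqrt (1 + d)\<close> comes from the step lemma, the other from
    bounding \<open>e'\<close>; together they make \<open>1 + d\<close>, a quarter of the square of
    \<open>\<beta>\<close>.\<close>
  have e': "sqrt (1 + d) * norm e' \<le> (1 + d) * \<epsilon>"
  proof -
    have "norm (\<A> (X - Xr)) \<le>
        sqrt (1 + d) * (norm (X - Xr) + 1 / sqrt (real r) * nuclear_norm (X - Xr))"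
      unfolding nuclear_norm_def
      using d assms(4) restricted_isometry_mono[OF rip]
      by (intro restricted_isometry_norm_le_nuclear[OF assms(2) _ _ _ svd]) auto
    moreover have "norm e \<le> sqrt (1 + d) * norm e"
      using d by (simp add: mult_le_cancel_right1)
    ultimately have "norm e' \<le> sqrt (1 + d) * \<epsilon>"
      using norm_triangle_ineq[of "\<A> (X - Xr)" e] unfolding e'_def assms(15)
      by (simp add: algebra_simps)
    then have "sqrt (1 + d) * norm e' \<le> sqrt (1 + d) * (sqrt (1 + d) * \<epsilon>)"
      using d by (intro mult_left_mono) auto
    then show ?thesis
      using d by (simp add: mult.assoc[symmetric])
  qed
  have iter: "Xs 0 = X0"
    "\<And>k. \<exists>S. is_shrinkage \<mu> (Xs k - adjoint \<A> (\<A> (Xs k) - b)) S \<and>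
      is_best_rank_approx r S (Xs (Suc k))"
    using assms(12) unfolding is_IHTMS_def by auto
  \<comment> \<open>The start has rank at most \<open>r\<close> by assumption, all later iterates
    because they are truncations.\<close>
  have rank: "rank (Xs k) \<le> r" for k
    using iter assms(11) rank_best_rank_approx_le by (cases k) (simp, blast)
  have step: "norm (Xr - Xs (Suc k)) \<le> \<alpha> * norm (Xr - Xs k) + (\<beta>\<^sup>2 / 2 * \<epsilon> + M)" for k
  proof -
    obtain S where S: "is_shrinkage \<mu> (Xs k - adjoint \<A> (\<A> (Xs k) - (\<A> Xr + e'))) S"
        "is_best_rank_approx r S (Xs (Suc k))"
      using iter(2)[of k] unfolding b by blast
    have "norm (Xr - Xs (Suc k)) \<le> 2 * d * norm (Xr - Xs k) + 2 * sqrt (1 + d) * norm e' + M"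
      unfolding M_def using d(1) assms(10)
      by (intro IHTMS_step[OF assms(2) rip _ assms(4) r _ rank_best_rank_approx_le[OF assms(9)]
            rank S]) auto
    moreover have "2 * d * norm (Xr - Xs k) \<le> \<alpha> * norm (Xr - Xs k)"
      using d(2) by (intro mult_right_mono) auto
    moreover have "\<beta>\<^sup>2 / 2 * \<epsilon> = 2 * ((1 + d) * \<epsilon>)"
      by (simp add: \<beta>)
    ultimately show ?thesis
      using e' by linarith
  qed
  \<comment> \<open>The first summand is the noise accumulated by the recurrence; the second pays
    for passing from \<open>Xr\<close> back to \<open>X\<close>.\<close>
  have \<gamma>: "\<gamma> * \<epsilon> = \<beta>\<^sup>2 / 2 * \<epsilon> / (1 - \<alpha>) + \<epsilon>"
    using assms(14) by (simp add: algebra_simps)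
  have bound: "norm (X - Xs k) \<le> \<alpha> ^ k * norm (Xr - X0) + \<gamma> * \<epsilon> + M / (1 - \<alpha>)" for k
  proof -
    have "norm (Xr - Xs k) \<le> \<alpha> ^ k * norm (Xr - Xs 0) + (\<beta>\<^sup>2 / 2 * \<epsilon> + M) / (1 - \<alpha>)"
      by (rule linear_recurrence_bound[where z = "\<lambda>k. norm (Xr - Xs k)", OF step])
         (use assms(6,7) \<epsilon> M in auto)
    then show ?thesis
      using norm_triangle_ineq[of "X - Xr" "Xr - Xs k"] \<epsilon>(1) \<gamma> iter(1)
      by (simp add: add_divide_distrib)
  qed
  have "norm (X - Xs k) \<le> (1 + \<gamma>) * \<epsilon> + (2 - \<alpha>) / (1 - \<alpha>) * M"
    if "k = nat \<lceil>log (1 / \<alpha>) (norm (Xr - X0) / (\<epsilon> + M))\<rceil>" for k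
  proof -
    \<comment> \<open>The iteration count is chosen so that the initial error has decayed to
      \<open>\<epsilon> + M\<close>, which adds one \<open>\<epsilon>\<close> and one
      \<open>M\<close> to the general bound.\<close>
    have "\<alpha> ^ k * norm (Xr - X0) \<le> \<epsilon> + M"
      by (rule power_mult_le_if_ceiling_log[OF assms(6,7) _ _ that]) (use \<epsilon>(2) M in auto)
    moreover have "(2 - \<alpha>) / (1 - \<alpha>) * M = M + M / (1 - \<alpha>)"
      using assms(7) by (simp add: field_simps)
    ultimately show ?thesis
      using bound[of k] by (simp add: algebra_simps)
  qed
  with bound show ?thesis
    unfolding M_def by blast
qed

end
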